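(* Let $k\ge 1$, let $W=(w_1,w_2,\ldots,w_{k-1})$ be any legal schedule, and write $Q_W(x;q)=\sum_{r=1}^k A_r(q)x^r$. Then $$\Big(1-\frac{q}{x}\Big)Q_W(x;q)+x^k(1-qx)\,Q_W(1/x;q)=(1+x^k)\big(A_k(q)-qA_1(q)\big)=(1+x^k)(1-q^2)\prod_{i=1}^{k-1}[w_i]_q .$$
   Context: For an integer $m\ge 0$, $[m]_q=1+q+\cdots+q^{m-1}$ (so $[0]_q=0$). A legal schedule is a (possibly empty) finite sequence of integers $W=(w_1,\ldots,w_{k-1})$, $k\ge 1$, with $1\le w_1\le 2$ and $1\le w_i\le w_{i-1}+1$ for $2\le i\le k-1$. Its alphabet is $X_k=\{x_{-1},x_0,x_1,\ldots,x_{k-1}\}$. Polynomials $P_W(X_k;q)$ are defined recursively: for the empty schedule ($k=1$), $P_{\emptyset}=q\,x_{-1}+x_0$; and for a legal schedule $W=(w_1,\ldots,w_{k-1})$ and an integer $w$ with $1\le w\le w_{k-1}+1$ (for $k=1$: $1\le w\le 2$), letting $W,w$ denote the schedule obtained by appending $w$ to $W$, $$P_{W,w}(X_{k+1};q)=\frac{x_k-q^w}{1-q}P_W(X_k;q)+\frac{1-x_k}{1-q}\Big(P_W(X_k;q)\Big|_{x_{k-i}\to q x_{k-i},\ 1\le i\le w}\Big).$$ The univariate polynomial $Q_W(x;q)$ is obtained from $P_W(X_k;q)$ by setting $x_i=x$ for all $-1\le i\le k-1$. It has degree $k$ in $x$ and no constant term. Empty products equal $1$. *)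

theory Defs
  imports
    "HOL-Library.Poly_Mapping"
    "HOL-Computational_Algebra.Polynomial_Factorial"
begin

type_synonym ratq = "rat poly fract"

definition qq :: ratq
  where "qq = to_fract [:0, 1:]"

definition qint :: "nat \<Rightarrow> ratq"
  where "qint m = (\<Sum>i<m. qq ^ i)"

text \<open>
  Polynomials in variables indexed by \<^typ>\<open>int\<close>, since the alphabet starts at $x_{-1}$.
\<close>

type_synonym 'a mpol = "(int \<Rightarrow>\<^sub>0 nat) \<Rightarrow>\<^sub>0 'a"

definition mconst :: "'a::zero \<Rightarrow> 'a mpol"
  where "mconst c = Poly_Mapping.single 0 c"

definition mvar :: "int \<Rightarrow> 'a::zero_neq_one mpol"
  where "mvar i = Poly_Mapping.single (Poly_Mapping.single i 1) 1"

text \<open>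
  Simultaneous substitution of \<open>f i\<close> for the variable with index \<open>i\<close>, where \<open>h\<close> embeds
  the coefficients into the target ring.
\<close>

definition msubst :: "('a::zero \<Rightarrow> 'b::comm_semiring_1) \<Rightarrow> (int \<Rightarrow> 'b) \<Rightarrow> 'a mpol \<Rightarrow> 'b"
  where "msubst h f p =
    (\<Sum>m\<in>Poly_Mapping.keys p.
       h (Poly_Mapping.lookup p m) *
       (\<Prod>i\<in>Poly_Mapping.keys m. f i ^ Poly_Mapping.lookup m i))"

text \<open>
  The entry $w_i$ is \<open>W ! (i - 1)\<close>. The entries of a legal schedule are positive, so
  lists of natural numbers suffice.
\<close>

definition legal_schedule :: "nat list \<Rightarrow> bool"
  where "legal_schedule W \<longleftrightarrow>
    (W \<noteq> [] \<longrightarrow> 1 \<le> W ! 0 \<and> W ! 0 \<le> 2) \<and>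
    (\<forall>j. Suc j < length W \<longrightarrow> 1 \<le> W ! Suc j \<and> W ! Suc j \<le> W ! j + 1)"

definition scale_last :: "nat \<Rightarrow> nat \<Rightarrow> ratq mpol \<Rightarrow> ratq mpol"
  where "scale_last k w p =
    msubst mconst
      (\<lambda>j. if \<exists>i::nat. 1 \<le> i \<and> i \<le> w \<and> j = int k - int i then mconst qq * mvar j else mvar j) p"

text \<open>The schedule is given in reverse here, since the recursion appends at its end.\<close>

primrec P_rev :: "nat list \<Rightarrow> ratq mpol"
  where
    "P_rev [] = mconst qq * mvar (-1) + mvar 0"
  | "P_rev (w # V) =
      (let k = length V + 1 in
        mconst (1 / (1 - qq)) * (mvar (int k) - mconst (qq ^ w)) * P_rev V +
        mconst (1 / (1 - qq)) * (1 - mvar (int k)) * scale_last k w (P_rev V))"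

definition P_poly :: "nat list \<Rightarrow> ratq mpol"
  where "P_poly W = P_rev (rev W)"

lemma P_poly_Nil: "P_poly [] = mconst qq * mvar (-1) + mvar 0"
  by (simp add: P_poly_def)

lemma P_poly_append:
  assumes "k = length W + 1"
  shows "P_poly (W @ [w]) =
    mconst (1 / (1 - qq)) * (mvar (int k) - mconst (qq ^ w)) * P_poly W +
    mconst (1 / (1 - qq)) * (1 - mvar (int k)) * scale_last k w (P_poly W)"
  using assms by (simp add: P_poly_def Let_def)

definition Q_poly :: "nat list \<Rightarrow> ratq poly"
  where "Q_poly W = msubst (\<lambda>c. [:c:]) (\<lambda>_. [:0, 1:]) (P_poly W)"

text \<open>\<open>ratqx\<close> is $\mathbb{Q}(q)(x)$, with \<open>xx\<close> as $x$; \<open>ratq\<close> is $\mathbb{Q}(q)$, with \<open>qq\<close> as $q$.\<close>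

type_synonym ratqx = "ratq poly fract"

definition emb :: "ratq \<Rightarrow> ratqx"
  where "emb c = to_fract [:c:]"

definition xx :: ratqx
  where "xx = to_fract [:0, 1:]"

definition eval_at :: "ratq poly \<Rightarrow> ratqx \<Rightarrow> ratqx"
  where "eval_at p y = poly (map_poly emb p) y"

end

theory Submission
  imports Defs
begin

text \<open>
Multiplied by \<open>1 - q\<close>, one step of the recursion reads
\<open>x\<^sub>k P - x\<^sub>k \<sigma>(P) + \<sigma>(P) - q\<^sup>w P\<close>, where \<open>\<sigma>\<close> scales the last \<open>w\<close> variables by \<open>q\<close>.
Read each of the four terms as a letter that is written down at step \<open>k\<close>: the letters \<open>P1\<close> and
\<open>N1\<close> contribute \<open>x\<^sub>k\<close>, the letters \<open>P0\<close> and \<open>N0\<close> do not (their colour says whether \<open>x\<^sub>k\<close>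
divides the monomial), \<open>P\<close> carries the sign \<open>+\<close> and \<open>N\<close> the sign \<open>-\<close>. Then
\<open>(1 - q)\<^bsup>k-1\<^esup> Q\<^sub>W(x)\<close> is a sum over words of length \<open>k + 1\<close>, in which a new letter \<open>c\<close> is weighted
by \<open>\<plusminus>1\<close> or \<open>\<plusminus>x\<close> times \<open>q\<close> to the number of letters among the last \<open>w\<close> that are smaller than
\<open>c\<close>, or equal to \<open>c\<close> if \<open>c\<close> is negative, for the order \<open>P1 < N1 < P0 < N0\<close>. These are the weights of
a unicellular LLT polynomial in a signed alphabet. Substituting \<open>1/x\<close> for \<open>x\<close> and clearing
denominators interchanges the colours, that is, it replaces the order by \<open>P0 < N0 < P1 < N1\<close>.

LLT polynomials are symmetric, hence do not see the order of the alphabet. Here the first two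
letters are prescribed, and a change of the order changes them by an explicit linear map. Such a
map is an intertwiner between the two weightings; that it transforms the total weights of all
continuations as well (\<open>intertwiner.continuations_eq\<close>) needs only that it is compatible with one step
and with forgetting the oldest letter, because by legality a letter that has left the window never
returns to it. Exchanging neighbours of opposite sign is done by \<open>blend\<close>, exchanging neighbours of
equal sign by \<open>mix\<close>. Four exchanges turn one order into the other. Evaluated at words of length two
they give \<open>reversal\<close>, two linear relations between the sums for \<open>Q\<^sub>W(x)\<close> and those for \<open>Q\<^sub>W(1/x)\<close>.
The remaining terms start from two letters of the same colour; there the contributions of the other
colour cancel and the sum is a product of the factors \<open>1 - q\<^bsup>w\<^esup>\<close>. The combination of the two
relations that belongs to \<open>P\<^sub>\<emptyset> = q x\<^sub>-\<^sub>1 + x\<^sub>0\<close> is the functional equation with the explicit product on the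
right, and the value of \<open>A\<^sub>k - q A\<^sub>1\<close> is its coefficient of \<open>x\<^sup>k\<close>.
\<close>

section \<open>Words in signed, coloured letters\<close>

text \<open>
The digit is the colour, and \<open>P\<close> or \<open>N\<close> gives the sign.
\<close>

datatype letter = P1 | N1 | P0 | N0

lemma UNIV_letter: "UNIV = {P1, N1, P0, N0}"
  using letter.exhaust by auto

instance letter :: finite
  by standard (simp add: UNIV_letter)

lemma sum_letter: "(\<Sum>c\<in>UNIV. g c) = g P1 + g N1 + g P0 + (g N0 :: 'a::comm_monoid_add)"
  by (simp add: UNIV_letter ac_simps)

definition words :: "nat \<Rightarrow> letter list set"
  where "words n = {u. length u = n}"

lemma words_0 [simp]: "words 0 = {[]}"
  by (auto simp: words_def)

lemma finite_words [simp]: "finite (words n)"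
  unfolding words_def using finite_lists_length_eq[of "UNIV :: letter set" n] by simp

lemma sum_words_Cons:
  fixes g :: "letter list \<Rightarrow> 'a::comm_monoid_add"
  shows "(\<Sum>u\<in>words (Suc n). g u) = (\<Sum>c\<in>UNIV. \<Sum>u\<in>words n. g (c # u))"
proof -
  have "bij_betw (\<lambda>(c, u). c # u) (UNIV \<times> words n) (words (Suc n))"
    by (rule bij_betwI') (auto simp: words_def length_Suc_conv)
  then have "(\<Sum>u\<in>words (Suc n). g u) = (\<Sum>(c, u)\<in>UNIV \<times> words n. g (c # u))"
    by (subst sum.reindex_bij_betw[symmetric]) (auto simp: case_prod_unfold)
  then show ?thesis
    by (simp add: sum.cartesian_product)
qed

lemma sum_words_2:
  "(\<Sum>u\<in>words (Suc (Suc 0)). g u) = (\<Sum>c\<in>UNIV. \<Sum>d\<in>UNIV. (g [c, d] :: 'a::comm_monoid_add))"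
  by (simp add: sum_words_Cons)

lemma sum_words_snoc:
  fixes g :: "letter list \<Rightarrow> 'a::comm_monoid_add"
  shows "(\<Sum>u\<in>words (Suc n). g u) = (\<Sum>u\<in>words n. \<Sum>c\<in>UNIV. g (u @ [c]))"
proof -
  have "bij_betw (\<lambda>(u, c). u @ [c]) (words n \<times> UNIV) (words (Suc n))"
  proof (rule bij_betwI')
    fix w assume "w \<in> words (Suc n)"
    then show "\<exists>p\<in>words n \<times> UNIV. w = (case p of (u, c) \<Rightarrow> u @ [c])"
      by (intro bexI[of _ "(butlast w, last w)"])
        (auto simp: words_def intro!: append_butlast_last_id[symmetric])
  qed (auto simp: words_def)
  then have "(\<Sum>u\<in>words (Suc n). g u) = (\<Sum>(u, c)\<in>words n \<times> UNIV. g (u @ [c]))"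
    by (subst sum.reindex_bij_betw[symmetric]) (auto simp: case_prod_unfold)
  then show ?thesis
    by (simp add: sum.cartesian_product)
qed

text \<open>
Words are written with the newest letter first, so that the window of width \<open>w\<close> is \<open>take w u\<close>. The
result is the total weight of all ways to continue \<open>u\<close> according to the schedule \<open>f\<close>.
\<close>

primrec continuations :: "(letter \<Rightarrow> letter list \<Rightarrow> 'a::comm_ring_1) \<Rightarrow> nat list \<Rightarrow> letter list \<Rightarrow> 'a"
  where
    "continuations wt [] u = 1"
  | "continuations wt (w # f) u = (\<Sum>c\<in>UNIV. wt c (take w u) * continuations wt f (c # u))"

text \<open>
Here \<open>m\<close> bounds the first entry. It is the number of letters that the first window may see, so
\<open>m = 2\<close> for a whole schedule, which starts from two letters.
\<close>

fun legal :: "nat \<Rightarrow> nat list \<Rightarrow> bool"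
  where
    "legal m [] = True"
  | "legal m (w # f) = (w \<le> m \<and> legal (Suc w) f)"

lemma continuations_take: "legal m f \<Longrightarrow> continuations wt f (take m u) = continuations wt f u"
proof (induction f arbitrary: m u)
  case (Cons w f)
  have "continuations wt f (c # take m u) = continuations wt f (c # u)" for c
  proof -
    have "continuations wt f (c # take m u) = continuations wt f (take (Suc w) (c # take m u))"
      using Cons.IH[of "Suc w" "c # take m u"] Cons.prems by simp
    also have "take (Suc w) (c # take m u) = take (Suc w) (c # u)"
      using Cons by (simp add: min_def)
    also have "continuations wt f \<dots> = continuations wt f (c # u)"
      using Cons.IH[of "Suc w" "c # u"] Cons.prems by simp
    finally show ?thesis .
  qed
  moreover have "take w (take m u) = take w u"
    using Cons.prems by (simp add: min_def)
  ultimately show ?case by simp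
qed simp

text \<open>
\<open>T\<close> rewrites words for the weighting \<open>wt\<close> as combinations of words of the same length for the
weighting \<open>wt'\<close>. The condition \<open>marginal\<close> makes \<open>T\<close> commute with forgetting the oldest letter, so
\<open>step\<close> has to be known only for windows that contain the whole word.
\<close>

locale intertwiner =
  fixes wt wt' :: "letter \<Rightarrow> letter list \<Rightarrow> 'a::comm_ring_1"
    and T :: "letter list \<Rightarrow> letter list \<Rightarrow> 'a"
  assumes T_Nil: "T [] [] = 1"
    and marginal: "\<And>u v c. length u = length v \<Longrightarrow> (\<Sum>d\<in>UNIV. T (u @ [c]) (v @ [d])) = T u v"
    and step: "\<And>u v d. length u = length v \<Longrightarrow>
      (\<Sum>c\<in>UNIV. wt c u * T (c # u) (d # v)) = T u v * wt' d v"
begin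

lemma sum_take:
  "w \<le> length u \<Longrightarrow>
    (\<Sum>v\<in>words (length u). T u v * g (take w v)) = (\<Sum>v\<in>words w. T (take w u) v * g v)"
proof (induction u rule: rev_induct)
  case Nil
  then show ?case by simp
next
  case (snoc c u)
  show ?case
  proof (cases "w = length (u @ [c])")
    case True
    then show ?thesis
      by (intro sum.cong) (auto simp: words_def)
  next
    case False
    with snoc.prems have w: "w \<le> length u" by simp
    have "(\<Sum>v\<in>words (length (u @ [c])). T (u @ [c]) v * g (take w v))
      = (\<Sum>v\<in>words (length u). \<Sum>d\<in>UNIV. T (u @ [c]) (v @ [d]) * g (take w v))"
      using w by (simp add: sum_words_snoc) (auto simp: words_def intro!: sum.cong)
    also have "\<dots> = (\<Sum>v\<in>words (length u). T u v * g (take w v))"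
    proof (rule sum.cong[OF refl])
      fix v assume "v \<in> words (length u)"
      then show "(\<Sum>d\<in>UNIV. T (u @ [c]) (v @ [d]) * g (take w v)) = T u v * g (take w v)"
        using marginal[of u v c] by (simp add: words_def flip: sum_distrib_right)
    qed
    finally show ?thesis using snoc.IH w by simp
  qed
qed

text \<open>
Induction on the schedule. A window of width \<open>w\<close> is always followed by windows of width at most
\<open>w + 1\<close>, so a word may be cut down to its window before \<open>step\<close> is applied.
\<close>

lemma continuations_eq:
  "legal (length u) f \<Longrightarrow> continuations wt f u = (\<Sum>v\<in>words (length u). T u v * continuations wt' f v)"
proof (induction f arbitrary: u)
  case Nil
  then show ?case using sum_take[of 0 u "\<lambda>_. 1"] by (simp add: T_Nil)
next
  case (Cons w f)
  let ?u = "take w u"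
  have w: "w \<le> length u" and f: "legal (Suc w) f" using Cons.prems by auto
  have lw: "legal w (w # f)" using f by simp
  have len: "length ?u = w" using w by simp
  have "continuations wt (w # f) u = continuations wt (w # f) ?u"
    by (simp only: continuations_take[OF lw])
  also have "\<dots> = (\<Sum>c\<in>UNIV. wt c ?u * (\<Sum>v\<in>words (Suc w). T (c # ?u) v * continuations wt' f v))"
    using f len by (simp add: Cons.IH del: length_take)
  also have "\<dots> = (\<Sum>c\<in>UNIV. \<Sum>d\<in>UNIV. \<Sum>v\<in>words w.
      wt c ?u * (T (c # ?u) (d # v) * continuations wt' f (d # v)))"
    by (simp only: sum_words_Cons sum_distrib_left)
  also have "\<dots> = (\<Sum>v\<in>words w. \<Sum>d\<in>UNIV. \<Sum>c\<in>UNIV.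
      wt c ?u * (T (c # ?u) (d # v) * continuations wt' f (d # v)))"
    (is "_ = ?R")
  proof -
    let ?h = "\<lambda>c d v. wt c ?u * (T (c # ?u) (d # v) * continuations wt' f (d # v))"
    have "(\<Sum>c\<in>UNIV. \<Sum>d\<in>UNIV. \<Sum>v\<in>words w. ?h c d v)
      = (\<Sum>c\<in>UNIV. \<Sum>v\<in>words w. \<Sum>d\<in>UNIV. ?h c d v)"
      by (intro sum.cong[OF refl] sum.swap)
    also have "\<dots> = (\<Sum>v\<in>words w. \<Sum>c\<in>UNIV. \<Sum>d\<in>UNIV. ?h c d v)"
      by (rule sum.swap)
    also have "\<dots> = ?R"
      by (intro sum.cong[OF refl] sum.swap)
    finally show ?thesis .
  qed
  also have "\<dots> = (\<Sum>v\<in>words w. \<Sum>d\<in>UNIV. T ?u v * wt' d v * continuations wt' f (d # v))"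
  proof (intro sum.cong refl)
    fix v d assume "v \<in> words w"
    then have "length ?u = length v" using len by (simp add: words_def del: length_take)
    from step[OF this, of d]
    show "(\<Sum>c\<in>UNIV. wt c ?u * (T (c # ?u) (d # v) * continuations wt' f (d # v)))
      = T ?u v * wt' d v * continuations wt' f (d # v)"
      by (simp flip: sum_distrib_right mult.assoc)
  qed
  also have "\<dots> = (\<Sum>v\<in>words w. T ?u v * continuations wt' (w # f) v)"
    by (intro sum.cong refl) (simp add: words_def sum_distrib_left mult.assoc)
  also have "\<dots> = (\<Sum>v\<in>words (length u). T u v * continuations wt' (w # f) (take w v))"
    by (rule sum_take[OF w, symmetric])
  also have "\<dots> = (\<Sum>v\<in>words (length u). T u v * continuations wt' (w # f) v)"
    by (simp only: continuations_take[OF lw])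
  finally show ?case .
qed

end

section \<open>Exchanging adjacent letters\<close>

primrec negative :: "letter \<Rightarrow> bool"
  where "negative P1 = False" | "negative N1 = True" | "negative P0 = False" | "negative N0 = True"

primrec val :: "'a::comm_ring_1 \<Rightarrow> letter \<Rightarrow> 'a"
  where "val x P1 = x" | "val x N1 = - x" | "val x P0 = 1" | "val x N0 = - 1"

text \<open>
The list \<open>L\<close> is the order of the alphabet, smallest letter first.
\<close>

definition weight :: "'a::comm_ring_1 \<Rightarrow> 'a \<Rightarrow> letter list \<Rightarrow> letter \<Rightarrow> letter list \<Rightarrow> 'a"
  where "weight q x L c u = val x c *
    q ^ sum_list (map (count_list u) (takeWhile (\<lambda>e. e \<noteq> c) L @ (if negative c then [c] else [])))"

text \<open>
Let \<open>a\<close> be positive, \<open>b\<close> negative. If \<open>a\<close> directly precedes \<open>b\<close>, no weight distinguishes an old \<open>a\<close>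
from an old \<open>b\<close>: both count as smaller than every later \<open>b\<close> and as not smaller than every later \<open>a\<close>. The two
letters together then have weight proportional to \<open>val x a + q\<^sup>k val x b\<close>, with \<open>k\<close> the number of letters
\<open>a\<close>, \<open>b\<close> in the window. If \<open>b\<close> directly precedes \<open>a\<close>, a new \<open>a\<close> and a new \<open>b\<close> are both weighted by
the number of old \<open>b\<close>. Dividing the second weights by the first distributes
the positions occupied by \<open>a\<close> and \<open>b\<close> anew.
\<close>

fun blend :: "'a::field \<Rightarrow> 'a \<Rightarrow> letter \<Rightarrow> letter \<Rightarrow> letter list \<Rightarrow> letter list \<Rightarrow> 'a"
  where
    "blend q x a b [] [] = 1"
  | "blend q x a b (c # u) (d # v) = blend q x a b u v *
      (if c \<in> {a, b} then
        if d \<in> {a, b}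
        then val x d * q ^ count_list v b / (val x a + q ^ (count_list u a + count_list u b) * val x b)
        else 0
      else if d = c then 1 else 0)"
  | "blend q x a b _ _ = 0"

lemma blend_counts:
  assumes "length u = length v" "blend q x a b u v \<noteq> 0" "a \<noteq> b"
  shows "count_list v a + count_list v b = count_list u a + count_list u b"
    and "e \<notin> {a, b} \<Longrightarrow> count_list v e = count_list u e"
  using assms by (induction u v rule: list_induct2) (auto split: if_splits)

text \<open>
The kernel is defined letter by letter from the oldest to the newest. It has an equally simple
factorisation in the opposite direction, because an oldest \<open>b\<close> adds one factor \<open>q\<close> for each later letter
\<open>a\<close> or \<open>b\<close>. The same holds for \<open>mix\<close> below.
\<close>

lemma blend_snoc:
  assumes "length u = length v" "a \<noteq> b"
  shows "blend q x a b (u @ [c]) (v @ [d]) = blend q x a b u v *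
    (if c \<in> {a, b} then
      (if d = a then val x a else if d = b then q ^ (count_list u a + count_list u b) * val x b else 0)
        / (val x a + q ^ (count_list u a + count_list u b) * val x b)
    else if d = c then 1 else 0)"
  using assms(1)
proof (induction u v rule: list_induct2)
  case Nil
  then show ?case using assms(2) by simp
next
  case (Cons e u f v)
  then show ?case
    using assms(2) by (auto simp: field_simps)
qed

lemma blend_marginal:
  assumes "length u = length v" "a \<noteq> b" "\<And>k. val x a + q ^ k * val x b \<noteq> 0"
  shows "(\<Sum>d\<in>UNIV. blend q x a b (u @ [c]) (v @ [d])) = blend q x a b u v"
proof -
  let ?k = "count_list u a + count_list u b"
  have "(\<Sum>d\<in>UNIV. (if c \<in> {a, b} then
      (if d = a then val x a else if d = b then q ^ ?k * val x b else 0)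
        / (val x a + q ^ ?k * val x b)
    else if d = c then 1 else 0)) = 1"
  proof (cases "c \<in> {a, b}")
    case True
    have "(\<Sum>d\<in>UNIV. (if d = a then val x a else if d = b then q ^ ?k * val x b else 0))
      = (\<Sum>d\<in>UNIV. (if d = a then val x a else 0) + (if d = b then q ^ ?k * val x b else 0))"
      using assms(2) by (intro sum.cong) auto
    also have "\<dots> = val x a + q ^ ?k * val x b"
      by (simp add: sum.distrib)
    finally show ?thesis
      using True assms(3)[of ?k] by (simp flip: sum_divide_distrib)
  qed simp
  then show ?thesis
    by (simp add: blend_snoc[OF assms(1,2)] flip: sum_distrib_left)
qed

text \<open>
Exchanges two neighbours \<open>a\<close> and \<open>b\<close> of equal sign: every \<open>b\<close> becomes an \<open>a\<close>, and the letters
\<open>a\<close> are redistributed over \<open>a\<close> and \<open>b\<close>, where \<open>y\<close> is the value of \<open>b\<close> divided by that of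
\<open>a\<close>. This is the local form of the symmetry of LLT polynomials in two variables. For positive letters
\<open>a\<close> moves from below \<open>b\<close> to above \<open>b\<close>; for negative letters it moves the other way, and the base
\<open>p\<close> is \<open>1/q\<close> in place of \<open>q\<close>.
\<close>

fun mix :: "'a::field \<Rightarrow> 'a \<Rightarrow> letter \<Rightarrow> letter \<Rightarrow> letter list \<Rightarrow> letter list \<Rightarrow> 'a"
  where
    "mix p y a b [] [] = 1"
  | "mix p y a b (c # u) (d # v) = mix p y a b u v *
      (if c = a then
        if d = a then (1 - p ^ count_list (zip u v) (a, a) * y) * p ^ count_list v b
        else if d = b then y else 0
      else if c = b then if d = a then 1 else 0
      else if d = c then 1 else 0)"
  | "mix p y a b _ _ = 0"

lemma mix_counts:
  assumes "length u = length v" "mix p y a b u v \<noteq> 0" "a \<noteq> b"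
  shows "count_list u a = count_list (zip u v) (a, a) + count_list v b"
    and "count_list v a = count_list (zip u v) (a, a) + count_list u b"
    and "e \<notin> {a, b} \<Longrightarrow> count_list v e = count_list u e"
  using assms by (induction u v rule: list_induct2) (auto split: if_splits)

lemma mix_snoc:
  assumes "length u = length v" "a \<noteq> b"
  shows "mix p y a b (u @ [c]) (v @ [d]) = mix p y a b u v *
    (if c = a then
      if d = a then 1 - p ^ count_list (zip u v) (a, a) * y
      else if d = b then p ^ count_list (zip u v) (a, a) * y else 0
    else if c = b then if d = a then 1 else 0
    else if d = c then 1 else 0)"
  using assms(1)
proof (induction u v rule: list_induct2)
  case Nil
  then show ?case using assms(2) by simp
next
  case (Cons e u f v)
  then show ?case
    using assms(2) by (auto simp: algebra_simps)
qed

lemma mix_marginal: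
  assumes "length u = length v" "a \<noteq> b"
  shows "(\<Sum>d\<in>UNIV. mix p y a b (u @ [c]) (v @ [d])) = mix p y a b u v"
proof -
  let ?n = "count_list (zip u v) (a, a)"
  have "(\<Sum>d\<in>UNIV. (if c = a then
      if d = a then 1 - p ^ ?n * y else if d = b then p ^ ?n * y else 0
    else if c = b then if d = a then 1 else 0
    else if d = c then 1 else 0)) = 1"
  proof (cases "c = a")
    case True
    have "(\<Sum>d\<in>UNIV. (if d = a then 1 - p ^ ?n * y else if d = b then p ^ ?n * y else 0))
      = (\<Sum>d\<in>UNIV. (if d = a then 1 - p ^ ?n * y else 0) + (if d = b then p ^ ?n * y else 0))"
      using assms(2) by (intro sum.cong) auto
    then show ?thesis
      using True by (simp add: sum.distrib)
  next
    case False
    then show ?thesis by (cases "c = b") simp_all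
  qed
  then show ?thesis
    by (simp add: mix_snoc[OF assms] flip: sum_distrib_left)
qed

text \<open>
The digits are the colours from the smallest to the largest letter; in each colour the
positive letter precedes the negative one.
\<close>

abbreviation "order_1100 \<equiv> [P1, N1, P0, N0]"
abbreviation "order_1010 \<equiv> [P1, P0, N1, N0]"
abbreviation "order_0110 \<equiv> [P0, P1, N1, N0]"
abbreviation "order_0101 \<equiv> [P0, P1, N0, N1]"
abbreviation "order_0011 \<equiv> [P0, N0, P1, N1]"

context
  fixes q x :: "'a::field"
  assumes q0: "q \<noteq> 0" and x0: "x \<noteq> 0"
    and xq: "\<And>k. x \<noteq> q ^ k" and qx: "\<And>k. q ^ k * x \<noteq> 1"
begin

lemma intertwiner_1010_1100:
  "intertwiner (weight q x order_1010) (weight q x order_1100) (blend q x P0 N1)"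
proof
  show "(\<Sum>d\<in>UNIV. blend q x P0 N1 (u @ [c]) (v @ [d])) = blend q x P0 N1 u v"
    if "length u = length v" for u v c
    by (rule blend_marginal[OF that]) (use qx in \<open>auto simp: algebra_simps\<close>)
  show "(\<Sum>c\<in>UNIV. weight q x order_1010 c u * blend q x P0 N1 (c # u) (d # v))
      = blend q x P0 N1 u v * weight q x order_1100 d v" if "length u = length v" for u v d
  proof (cases "blend q x P0 N1 u v = 0")
    case True
    then show ?thesis by simp
  next
    case False
    note cnt = blend_counts[OF that False]
    have pw: "q ^ count_list v P0 * q ^ count_list v N1 = q ^ count_list u P0 * q ^ count_list u N1"
      using cnt(1) by (simp flip: power_add)
    have "1 - q ^ count_list u P0 * q ^ count_list u N1 * x \<noteq> 0"
      using qx[of "count_list u P0 + count_list u N1"] by (simp add: power_add)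
    then show ?thesis
      using pw cnt(2)[of P1] cnt(2)[of N0]
      by (cases d; simp add: sum_letter weight_def power_add divide_simps; simp add: algebra_simps)
  qed
qed simp

lemma intertwiner_1010_0110:
  "intertwiner (weight q x order_1010) (weight q x order_0110) (mix q (1 / x) P1 P0)"
proof
  show "(\<Sum>d\<in>UNIV. mix q (1 / x) P1 P0 (u @ [c]) (v @ [d])) = mix q (1 / x) P1 P0 u v"
    if "length u = length v" for u v c
    by (rule mix_marginal[OF that]) simp
  show "(\<Sum>c\<in>UNIV. weight q x order_1010 c u * mix q (1 / x) P1 P0 (c # u) (d # v))
      = mix q (1 / x) P1 P0 u v * weight q x order_0110 d v" if "length u = length v" for u v d
  proof (cases "mix q (1 / x) P1 P0 u v = 0")
    case True
    then show ?thesis by simp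
  next
    case False
    note cnt = mix_counts[OF that False]
    show ?thesis
      using cnt(1,2) cnt(3)[of N1] cnt(3)[of N0] x0
      by (cases d) (simp_all add: sum_letter weight_def field_simps power_add)
  qed
qed simp

lemma intertwiner_0110_0101:
  "intertwiner (weight q x order_0110) (weight q x order_0101) (mix (1 / q) x N0 N1)"
proof
  show "(\<Sum>d\<in>UNIV. mix (1 / q) x N0 N1 (u @ [c]) (v @ [d])) = mix (1 / q) x N0 N1 u v"
    if "length u = length v" for u v c
    by (rule mix_marginal[OF that]) simp
  show "(\<Sum>c\<in>UNIV. weight q x order_0110 c u * mix (1 / q) x N0 N1 (c # u) (d # v))
      = mix (1 / q) x N0 N1 u v * weight q x order_0101 d v" if "length u = length v" for u v d
  proof (cases "mix (1 / q) x N0 N1 u v = 0")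
    case True
    then show ?thesis by simp
  next
    case False
    note cnt = mix_counts[OF that False]
    show ?thesis
      using cnt(1,2) cnt(3)[of P1] cnt(3)[of P0] q0
      by (cases d) (simp_all add: sum_letter weight_def field_simps power_add)
  qed
qed simp

lemma intertwiner_0101_0011:
  "intertwiner (weight q x order_0101) (weight q x order_0011) (blend q x P1 N0)"
proof
  show "(\<Sum>d\<in>UNIV. blend q x P1 N0 (u @ [c]) (v @ [d])) = blend q x P1 N0 u v"
    if "length u = length v" for u v c
    by (rule blend_marginal[OF that]) (use xq in \<open>auto simp: algebra_simps\<close>)
  show "(\<Sum>c\<in>UNIV. weight q x order_0101 c u * blend q x P1 N0 (c # u) (d # v))
      = blend q x P1 N0 u v * weight q x order_0011 d v" if "length u = length v" for u v d
  proof (cases "blend q x P1 N0 u v = 0")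
    case True
    then show ?thesis by simp
  next
    case False
    note cnt = blend_counts[OF that False]
    have pw: "q ^ count_list v P1 * q ^ count_list v N0 = q ^ count_list u P1 * q ^ count_list u N0"
      using cnt(1) by (simp flip: power_add)
    have "x - q ^ count_list u P1 * q ^ count_list u N0 \<noteq> 0"
      using xq[of "count_list u P1 + count_list u N0"] by (simp add: power_add)
    then show ?thesis
      using pw cnt(2)[of P0] cnt(2)[of N1]
      by (cases d; simp add: sum_letter weight_def power_add divide_simps; simp add: algebra_simps)
  qed
qed simp

end

section \<open>Exchanging the two colours\<close>

text \<open>
Replacing \<open>x\<close> by \<open>1/x\<close> and multiplying by \<open>x\<close> turns the values \<open>x, -x, 1, -1\<close> into \<open>1, -1, x, -x\<close>.
\<close>

primrec recolour :: "letter \<Rightarrow> letter"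
  where "recolour P1 = P0" | "recolour N1 = N0" | "recolour P0 = P1" | "recolour N0 = N1"

lemma continuations_inverse:
  fixes q x :: "'a::field"
  assumes "x \<noteq> 0"
  shows "x ^ length f * continuations (weight q (1 / x) order_1100) f u =
    continuations (weight q x order_0011) f (map recolour u)"
proof (induction f arbitrary: u)
  case Nil
  then show ?case by simp
next
  case (Cons w f)
  have cnt: "count_list (map recolour v) (recolour c) = count_list v c" for v c
    by (induction v) (auto, (case_tac a; cases c; simp)+)
  have wt: "x * weight q (1 / x) order_1100 c v = weight q x order_0011 (recolour c) (map recolour v)" for c v
    using cnt[of v P1] cnt[of v N1] cnt[of v P0] cnt[of v N0] assms
    by (cases c) (simp_all add: weight_def)
  have "x ^ length (w # f) * continuations (weight q (1 / x) order_1100) (w # f) u =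
    (\<Sum>c\<in>UNIV. x * weight q (1 / x) order_1100 c (take w u) *
      (x ^ length f * continuations (weight q (1 / x) order_1100) f (c # u)))"
    by (simp add: sum_distrib_left mult_ac)
  also have "\<dots> = (\<Sum>c\<in>UNIV. weight q x order_0011 (recolour c) (take w (map recolour u)) *
      continuations (weight q x order_0011) f (recolour c # map recolour u))"
    by (simp add: wt Cons.IH take_map)
  also have "\<dots> = continuations (weight q x order_0011) (w # f) (map recolour u)"
    by (simp add: sum_letter algebra_simps)
  finally show ?case .
qed

definition colour :: "letter \<Rightarrow> bool"
  where "colour c \<longleftrightarrow> c \<in> {P1, N1}"

lemma weight_0011:
  "weight q x order_0011 P0 u = 1"
  "weight q x order_0011 N0 u = - (q ^ (count_list u P0 + count_list u N0))"
  "weight q x order_0011 P1 u = x * q ^ (count_list u P0 + count_list u N0)"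
  "weight q x order_0011 N1 u = - x * q ^ (count_list u P0 + count_list u N0 + count_list u P1 + count_list u N1)"
  by (simp_all add: weight_def add.assoc)

lemma count_list_colour:
  "count_list (map colour u) True = count_list u P1 + count_list u N1"
  "count_list (map colour u) False = count_list u P0 + count_list u N0"
proof -
  have "c \<in> {P1, N1, P0, N0}" for c
    by (cases c) simp_all
  then show "count_list (map colour u) True = count_list u P1 + count_list u N1"
    "count_list (map colour u) False = count_list u P0 + count_list u N0"
    by (induction u) (auto simp: colour_def)
qed

text \<open>
In the order \<open>P0 < N0 < P1 < N1\<close> a letter is weighted by the number of letters of whole colours.
\<close>

lemma weight_colour:
  assumes "map colour u = map colour v"
  shows "weight q x order_0011 c u = weight q x order_0011 c v"
proof -
  have "count_list u P1 + count_list u N1 = count_list v P1 + count_list v N1"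
    "count_list u P0 + count_list u N0 = count_list v P0 + count_list v N0"
    using assms by (simp_all flip: count_list_colour)
  then show ?thesis
    by (cases c) (simp_all add: weight_0011 add.assoc)
qed

lemma continuations_colour:
  "map colour u = map colour v \<Longrightarrow>
    continuations (weight q x order_0011) f u = continuations (weight q x order_0011) f v"
proof (induction f arbitrary: u v)
  case (Cons w f)
  have "map colour (take w u) = map colour (take w v)"
    using Cons.prems by (simp flip: take_map)
  then show ?case
    using Cons by (auto intro!: sum.cong weight_colour arg_cong2[where f = "(*)"])
qed simp

text \<open>
While only one colour is present, the next letter may have the other colour with either sign, and these
two contributions cancel: the letters have opposite values and the same exponent. So the colour stays
constant, and its two signs contribute \<open>1 - q\<^bsup>w\<^esup>\<close>.
\<close>

lemma continuations_0:
  fixes q x :: "'a::comm_ring_1"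
  assumes "set u \<subseteq> {P0, N0}" "legal (length u) f"
  shows "continuations (weight q x order_0011) f u = (\<Prod>w\<leftarrow>f. 1 - q ^ w)"
  using assms
proof (induction f arbitrary: u)
  case (Cons w f)
  let ?F = "continuations (weight q x order_0011) f"
  have cnt: "count_list v P0 + count_list v N0 = length v \<and> count_list v P1 = 0 \<and> count_list v N1 = 0"
    if "set v \<subseteq> {P0, N0}" for v
    using that by (induction v) auto
  have t: "set (take w u) \<subseteq> {P0, N0}" "length (take w u) = w"
    using Cons.prems set_take_subset[of w u] by auto
  have eq: "?F (P1 # u) = ?F (N1 # u)"
    by (rule continuations_colour) (simp add: colour_def)
  have IH: "?F (c # u) = (\<Prod>w\<leftarrow>f. 1 - q ^ w)" if "c \<in> {P0, N0}" for c
  proof -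
    have "?F (c # u) = ?F (take (Suc w) (c # u))"
      by (rule continuations_take[symmetric]) (use Cons.prems in simp)
    also have "\<dots> = (\<Prod>w\<leftarrow>f. 1 - q ^ w)"
      using Cons.prems t that by (intro Cons.IH) auto
    finally show ?thesis .
  qed
  show ?case
    using cnt[OF t(1)] t(2) eq
    by (simp add: sum_letter IH weight_0011 algebra_simps)
qed simp

text \<open>
Here the letters of colour \<open>0\<close> have exponent \<open>0\<close>, and again they cancel.
\<close>

lemma continuations_1:
  fixes q x :: "'a::comm_ring_1"
  assumes "set u \<subseteq> {P1, N1}" "legal (length u) f"
  shows "continuations (weight q x order_0011) f u = x ^ length f * (\<Prod>w\<leftarrow>f. 1 - q ^ w)"
  using assms
proof (induction f arbitrary: u)
  case (Cons w f)
  let ?F = "continuations (weight q x order_0011) f"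
  have cnt: "count_list v P1 + count_list v N1 = length v \<and> count_list v P0 = 0 \<and> count_list v N0 = 0"
    if "set v \<subseteq> {P1, N1}" for v
    using that by (induction v) auto
  have t: "set (take w u) \<subseteq> {P1, N1}" "length (take w u) = w"
    using Cons.prems set_take_subset[of w u] by auto
  have eq: "?F (P0 # u) = ?F (N0 # u)"
    by (rule continuations_colour) (simp add: colour_def)
  have IH: "?F (c # u) = x ^ length f * (\<Prod>w\<leftarrow>f. 1 - q ^ w)" if "c \<in> {P1, N1}" for c
  proof -
    have "?F (c # u) = ?F (take (Suc w) (c # u))"
      by (rule continuations_take[symmetric]) (use Cons.prems in simp)
    also have "\<dots> = x ^ length f * (\<Prod>w\<leftarrow>f. 1 - q ^ w)"
      using Cons.prems t that by (intro Cons.IH) auto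
    finally show ?thesis .
  qed
  show ?case
    using cnt[OF t(1)] t(2) eq
    by (simp add: sum_letter IH weight_0011 algebra_simps)
qed simp

context
  fixes q x :: "'a::field" and f :: "nat list"
  assumes q0: "q \<noteq> 0" and x0: "x \<noteq> 0"
    and xq: "\<And>k. x \<noteq> q ^ k" and qx: "\<And>k. q ^ k * x \<noteq> 1"
    and f: "legal 2 f"
begin

abbreviation "F L u \<equiv> continuations (weight q x L) f u"

lemma swap_2:
  fixes T
  assumes "intertwiner (weight q x L) (weight q x L') T"
  shows "F L [c, d] = (\<Sum>c'\<in>UNIV. \<Sum>d'\<in>UNIV. T [c, d] [c', d'] * F L' [c', d'])"
  using intertwiner.continuations_eq[OF assms, of "[c, d]" f] f
  by (simp add: sum_words_2 numeral_2_eq_2)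

lemmas swaps =
  swap_2[OF intertwiner_1010_1100[OF q0 x0 xq qx]]
  swap_2[OF intertwiner_1010_0110[OF q0 x0 xq qx]]
  swap_2[OF intertwiner_0110_0101[OF q0 x0 xq qx]]
  swap_2[OF intertwiner_0101_0011[OF q0 x0 xq qx]]

lemma F_cases:
  "F order_0011 [P1, N1] = F order_0011 [P1, P1]" "F order_0011 [N1, P1] = F order_0011 [P1, P1]"
  "F order_0011 [N1, N1] = F order_0011 [P1, P1]"
  "F order_0011 [P0, N0] = F order_0011 [P0, P0]" "F order_0011 [N0, P0] = F order_0011 [P0, P0]"
  "F order_0011 [N0, N0] = F order_0011 [P0, P0]"
  "F order_0011 [P0, N1] = F order_0011 [P0, P1]" "F order_0011 [N0, P1] = F order_0011 [P0, P1]"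
  "F order_0011 [N0, N1] = F order_0011 [P0, P1]"
  "F order_0011 [P1, N0] = F order_0011 [P1, P0]" "F order_0011 [N1, P0] = F order_0011 [P1, P0]"
  "F order_0011 [N1, N0] = F order_0011 [P1, P0]"
  by (rule continuations_colour; simp add: colour_def)+

text \<open>
The four exchanges, applied to the words of length two that contain one positive letter of colour
\<open>1\<close> and one negative letter of colour \<open>0\<close>. With this choice of signs the first exchange, of \<open>N1\<close> and
\<open>P0\<close>, leaves the words alone, so it may be read in either direction. The denominators \<open>x - 1\<close> and \<open>x - q\<close> come from the
last exchange.
\<close>

lemma reversal:
  "(x - q) * F order_1100 [P1, N0] = (1 - q) * (F order_0011 [P0, P0] + x * F order_0011 [P1, P1]
      - F order_0011 [P0, P1]) + q * (x - 1) * F order_0011 [P1, P0]"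
  "(x - q) * F order_1100 [N0, P1] = (1 - q) * (F order_0011 [P0, P0] + x * F order_0011 [P1, P1]
      - x * F order_0011 [P1, P0]) + (x - 1) * F order_0011 [P0, P1]"
proof -
  have x1: "x - 1 \<noteq> 0" using xq[of 0] by simp
  have xq1: "x - q \<noteq> 0" using xq[of 1] by simp
  define G where "G = F order_0011"
  have one: "F order_0101 [P1, N1] = (x * G [P1, P1] - G [P0, P1]) / (x - 1)"
    "F order_0101 [N1, P1] = (x * G [P1, P1] - G [P1, P0]) / (x - 1)"
    "F order_0101 [P0, N0] = (x * G [P0, P1] - G [P0, P0]) / (x - 1)"
    "F order_0101 [N0, P0] = (x * G [P1, P0] - G [P0, P0]) / (x - 1)"
    "F order_0101 [P0, N1] = G [P0, P1]"
    "F order_0101 [N1, P0] = G [P1, P0]"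
    unfolding G_def by (simp_all add: swaps(4) sum_letter F_cases diff_divide_distrib)
  have two: "F order_0101 [P1, N0] = (x^2 * G [P1, P1] - q * x * G [P1, P0] - x * G [P0, P1] + q * G [P0, P0])
      / ((x - 1) * (x - q))"
    "F order_0101 [N0, P1] = F order_0101 [P1, N0]"
    unfolding G_def using x1 xq1
    by (simp_all add: swaps(4) sum_letter F_cases divide_simps) (simp_all add: algebra_simps power2_eq_square)
  have a: "F order_1100 [P1, N0] = (1 - 1 / x) * F order_0110 [P1, N0] + F order_0110 [P0, N0] / x"
    "F order_1100 [N0, P1] = (1 - 1 / x) * F order_0110 [N0, P1] + F order_0110 [N0, P0] / x"
    using swaps(1)[of P1 N0] swaps(2)[of P1 N0] swaps(1)[of N0 P1] swaps(2)[of N0 P1]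
    by (simp_all add: sum_letter)
  have b: "F order_0110 [P1, N0] = (1 - x) * F order_0101 [P1, N0] + x * F order_0101 [P1, N1]"
    "F order_0110 [P0, N0] = (1 - x) * F order_0101 [P0, N0] + x * F order_0101 [P0, N1]"
    "F order_0110 [N0, P1] = (1 - x) * F order_0101 [N0, P1] + x * F order_0101 [N1, P1]"
    "F order_0110 [N0, P0] = (1 - x) * F order_0101 [N0, P0] + x * F order_0101 [N1, P0]"
    by (simp_all add: swaps(3) sum_letter)
  show "(x - q) * F order_1100 [P1, N0] = (1 - q) * (F order_0011 [P0, P0] + x * F order_0011 [P1, P1]
      - F order_0011 [P0, P1]) + q * (x - 1) * F order_0011 [P1, P0]"
    unfolding a b one two G_def[symmetric] using x0 x1 xq1
    by (simp add: divide_simps) (simp add: algebra_simps power2_eq_square)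
  show "(x - q) * F order_1100 [N0, P1] = (1 - q) * (F order_0011 [P0, P0] + x * F order_0011 [P1, P1]
      - x * F order_0011 [P1, P0]) + (x - 1) * F order_0011 [P0, P1]"
    unfolding a b one two G_def[symmetric] using x0 x1 xq1
    by (simp add: divide_simps) (simp add: algebra_simps power2_eq_square)
qed

lemma functional_equation:
  "(x - q) * (F order_1100 [P1, N0] + q * F order_1100 [N0, P1])
    + (1 - q * x) * x ^ length f * (continuations (weight q (1 / x) order_1100) f [P1, N0]
        + q * continuations (weight q (1 / x) order_1100) f [N0, P1])
    = (1 - q^2) * (1 + x ^ (length f + 1)) * (\<Prod>w\<leftarrow>f. 1 - q ^ w)"
proof -
  have 0: "F order_0011 [P0, P0] = (\<Prod>w\<leftarrow>f. 1 - q ^ w)"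
    using f by (intro continuations_0) (simp_all add: numeral_2_eq_2)
  have 1: "F order_0011 [P1, P1] = x ^ length f * (\<Prod>w\<leftarrow>f. 1 - q ^ w)"
    using f by (intro continuations_1) (simp_all add: numeral_2_eq_2)
  have i: "x ^ length f * continuations (weight q (1 / x) order_1100) f [P1, N0] = F order_0011 [P0, P1]"
    "x ^ length f * continuations (weight q (1 / x) order_1100) f [N0, P1] = F order_0011 [P1, P0]"
    using continuations_inverse[OF x0, of f q "[P1, N0]"] continuations_inverse[OF x0, of f q "[N0, P1]"]
    by (simp_all add: F_cases)
  have "(x - q) * (F order_1100 [P1, N0] + q * F order_1100 [N0, P1])
      + (1 - q * x) * (F order_0011 [P0, P1] + q * F order_0011 [P1, P0])
    = (1 - q^2) * (F order_0011 [P0, P0] + x * F order_0011 [P1, P1])"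
  proof -
    have "(x - q) * (F order_1100 [P1, N0] + q * F order_1100 [N0, P1])
      = (x - q) * F order_1100 [P1, N0] + q * ((x - q) * F order_1100 [N0, P1])"
      by (simp add: algebra_simps)
    then show ?thesis
      unfolding reversal by (simp add: algebra_simps power2_eq_square)
  qed
  then show ?thesis
    by (simp add: 0 1 flip: i) (simp add: algebra_simps)
qed

end

section \<open>The recursion as a sum over words\<close>

locale comm_ring_map =
  fixes h :: "'a::comm_ring_1 \<Rightarrow> 'b::comm_ring_1"
  assumes map_1: "h 1 = 1"
    and map_add: "h (a + b) = h a + h b"
    and map_mult: "h (a * b) = h a * h b"
begin

lemma map_0: "h 0 = 0"
  using map_add[of 0 0] by simp

lemma map_uminus: "h (- a) = - h a"
  using map_add[of a "- a"] by (simp add: map_0 eq_neg_iff_add_eq_0 add.commute)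

lemma map_diff: "h (a - b) = h a - h b"
  using map_add[of a "- b"] by (simp add: map_uminus)

lemma map_power: "h (a ^ n) = h a ^ n"
  by (induction n) (simp_all add: map_1 map_mult)

lemma map_sum: "h (sum g I) = (\<Sum>i\<in>I. h (g i))"
  by (induction I rule: infinite_finite_induct) (simp_all add: map_0 map_add)

lemma map_prod: "h (prod g I) = (\<Prod>i\<in>I. h (g i))"
  by (induction I rule: infinite_finite_induct) (simp_all add: map_1 map_mult)

end

definition monomial_at :: "(int \<Rightarrow> 'b::comm_semiring_1) \<Rightarrow> (int \<Rightarrow>\<^sub>0 nat) \<Rightarrow> 'b"
  where "monomial_at X m = (\<Prod>i\<in>Poly_Mapping.keys m. X i ^ Poly_Mapping.lookup m i)"

lemma monomial_at_superset:
  assumes "finite S" "Poly_Mapping.keys m \<subseteq> S"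
  shows "monomial_at X m = (\<Prod>i\<in>S. X i ^ Poly_Mapping.lookup m i)"
  unfolding monomial_at_def using assms
  by (intro prod.mono_neutral_left) (auto simp: in_keys_iff)

lemma monomial_at_add: "monomial_at X (m + n) = monomial_at X m * monomial_at X n"
proof -
  let ?S = "Poly_Mapping.keys m \<union> Poly_Mapping.keys n"
  have "Poly_Mapping.keys (m + n) \<subseteq> ?S" by (rule Poly_Mapping.keys_add)
  then show ?thesis
    by (simp add: monomial_at_superset[of ?S] lookup_add power_add prod.distrib)
qed

lemma poly_mapping_eq_sum_single:
  "p = (\<Sum>m\<in>Poly_Mapping.keys p. Poly_Mapping.single m (Poly_Mapping.lookup p m))"
  by (rule poly_mapping_eqI)
    (auto simp: lookup_sum lookup_single when_def in_keys_iff sum.delta' )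

context comm_ring_map
begin

lemma msubst_superset:
  assumes "finite S" "Poly_Mapping.keys p \<subseteq> S"
  shows "msubst h X p = (\<Sum>m\<in>S. h (Poly_Mapping.lookup p m) * monomial_at X m)"
  unfolding msubst_def monomial_at_def[symmetric] using assms
  by (intro sum.mono_neutral_left) (auto simp: in_keys_iff map_0)

lemma msubst_add: "msubst h X (p + r) = msubst h X p + msubst h X r"
proof -
  let ?S = "Poly_Mapping.keys p \<union> Poly_Mapping.keys r"
  have "Poly_Mapping.keys (p + r) \<subseteq> ?S" by (rule Poly_Mapping.keys_add)
  then show ?thesis
    by (simp add: msubst_superset[of ?S] lookup_add map_add distrib_right sum.distrib)
qed

lemma msubst_single: "msubst h X (Poly_Mapping.single m c) = h c * monomial_at X m"
  by (subst msubst_superset[of "{m}"]) auto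

lemma msubst_sum: "msubst h X (sum g I) = (\<Sum>i\<in>I. msubst h X (g i))"
  by (induction I rule: infinite_finite_induct) (simp_all add: msubst_add, simp_all add: msubst_def)

lemma msubst_mult: "msubst h X (p * r) = msubst h X p * msubst h X r"
proof -
  let ?s = "\<lambda>p m. Poly_Mapping.single m (Poly_Mapping.lookup p m)"
  have "p * r = (\<Sum>m\<in>Poly_Mapping.keys p. \<Sum>n\<in>Poly_Mapping.keys r. ?s p m * ?s r n)"
    by (subst poly_mapping_eq_sum_single[of p], subst poly_mapping_eq_sum_single[of r])
      (rule sum_product)
  then have "msubst h X (p * r) = (\<Sum>m\<in>Poly_Mapping.keys p. \<Sum>n\<in>Poly_Mapping.keys r.
      (h (Poly_Mapping.lookup p m) * monomial_at X m) * (h (Poly_Mapping.lookup r n) * monomial_at X n))"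
    by (simp add: msubst_sum mult_single msubst_single monomial_at_add map_mult mult_ac)
  also have "\<dots> = msubst h X p * msubst h X r"
    unfolding msubst_def monomial_at_def[symmetric] by (rule sum_product[symmetric])
  finally show ?thesis .
qed

lemma msubst_mconst: "msubst h X (mconst c) = h c"
  by (simp add: mconst_def msubst_single monomial_at_def)

lemma msubst_mvar: "msubst h X (mvar i) = X i"
  by (simp add: mvar_def msubst_single monomial_at_def map_1)

lemma comm_ring_map_msubst: "comm_ring_map (msubst h X)"
proof
  show "msubst h X 1 = 1"
    using msubst_mconst[of X 1] by (simp add: mconst_def map_1)
qed (simp_all add: msubst_add msubst_mult)

lemma msubst_msubst: "msubst h X (msubst mconst g p) = msubst h (\<lambda>j. msubst h X (g j)) p"
proof -
  interpret ev: comm_ring_map "msubst h X" by (rule comm_ring_map_msubst)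
  show ?thesis
    unfolding msubst_def[of mconst]
    by (simp add: ev.map_sum ev.map_mult ev.map_prod ev.map_power msubst_mconst)
      (simp add: msubst_def)
qed

end

text \<open>
Weights of words with \<open>x = 1\<close>, over the schedule in reverse. The two initial words encode
\<open>q x\<^sub>-\<^sub>1 + x\<^sub>0\<close>: the newest of the two letters belongs to \<open>x\<^sub>0\<close>.
\<close>

primrec word_weight :: "'a::comm_ring_1 \<Rightarrow> nat list \<Rightarrow> letter list \<Rightarrow> 'a"
  where
    "word_weight q [] u = (if u = [P1, N0] then 1 else if u = [N0, P1] then q else 0)"
  | "word_weight q (w # V) u =
      word_weight q V (tl u) * weight q 1 order_1100 (hd u) (take w (tl u))"

primrec word_monomial :: "(int \<Rightarrow> 'a::comm_ring_1) \<Rightarrow> int \<Rightarrow> letter list \<Rightarrow> 'a"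
  where
    "word_monomial X k [] = 1"
  | "word_monomial X k (c # u) = (if colour c then X k else 1) * word_monomial X (k - 1) u"

text \<open>
Scaling the variables of a window multiplies a monomial by \<open>q\<close> for each letter of colour \<open>1\<close> in that window;
this is where the exponents of \<open>N1\<close> and \<open>P0\<close> in the order \<open>P1 < N1 < P0 < N0\<close> come from.
\<close>

lemma word_monomial_scaled:
  assumes "\<And>j. j \<le> k \<Longrightarrow> Y j = (if k - int w < j then q * X j else X j)"
  shows "word_monomial Y k u = q ^ count_list (map colour (take w u)) True * word_monomial X k u"
  using assms
proof (induction u arbitrary: k w)
  case (Cons c u)
  have "word_monomial Y (k - 1) u
    = q ^ count_list (map colour (take (w - 1) u)) True * word_monomial X (k - 1) u"
    by (rule Cons.IH) (use Cons.prems in auto)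
  then show ?case
    using Cons.prems[of k] by (cases w) (auto simp: algebra_simps)
qed simp

lemma word_monomial_const:
  "word_monomial (\<lambda>_. x) k u = x ^ count_list (map colour u) True"
  by (induction u arbitrary: k) (auto simp: algebra_simps)

lemma legal_snoc: "legal m (f @ [w]) \<Longrightarrow> legal m f \<and> w \<le> m + length f"
  by (induction f arbitrary: m) fastforce+

lemma weight_1100:
  "weight q x order_1100 P1 u = x"
  "weight q x order_1100 N1 u = - x * q ^ count_list (map colour u) True"
  "weight q x order_1100 P0 u = q ^ count_list (map colour u) True"
  "weight q x order_1100 N0 u = - (q ^ length u)"
proof -
  have "c \<in> {P1, N1, P0, N0}" for c by (cases c) simp_all
  then have "count_list u P1 + (count_list u N1 + (count_list u P0 + count_list u N0)) = length u"
    by (induction u) auto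
  then show "weight q x order_1100 N0 u = - (q ^ length u)"
    by (simp add: weight_def)
qed (simp_all add: weight_def count_list_colour add.commute)

text \<open>
The polynomials are evaluated both in polynomials over \<open>\<rat>(q)\<close>, to bound degrees, and in the
field \<open>\<rat>(q)(x)\<close>, where the exchanges can be carried out.
\<close>

locale schedule_evaluation = comm_ring_map h
  for h :: "ratq \<Rightarrow> 'b::comm_ring_1"
begin

lemma qq_neq_1: "qq \<noteq> 1"
  unfolding qq_def by (subst to_fract_1[symmetric], subst to_fract_eq_iff) (simp add: one_pCons)

lemma map_denominator: "(1 - h qq) * h (1 / (1 - qq)) = 1"
proof -
  have "(1 - h qq) * h (1 / (1 - qq)) = h ((1 - qq) * (1 / (1 - qq)))"
    by (simp only: map_mult map_diff map_1)
  also have "(1 - qq) * (1 / (1 - qq)) = 1"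
    using qq_neq_1 by simp
  finally show ?thesis by (simp add: map_1)
qed

lemma msubst_scale_last:
  "msubst h X (scale_last k w p) =
    msubst h (\<lambda>j. if \<exists>i::nat. 1 \<le> i \<and> i \<le> w \<and> j = int k - int i then h qq * X j else X j) p"
  unfolding scale_last_def msubst_msubst
  by (rule arg_cong[where f = "\<lambda>Y. msubst h Y p"])
    (auto simp: fun_eq_iff msubst_mult msubst_mconst msubst_mvar)

lemma msubst_P_rev:
  "legal 2 (rev V) \<Longrightarrow> (1 - h qq) ^ length V * msubst h X (P_rev V) =
    (\<Sum>u\<in>words (length V + 2). word_weight (h qq) V u * word_monomial X (int (length V)) u)"
proof (induction V arbitrary: X)
  case Nil
  show ?case
    by (simp add: numeral_2_eq_2 sum_words_2 sum_letter msubst_add msubst_mult msubst_mconst msubst_mvar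
        colour_def add.commute)
next
  case (Cons w V)
  define q where "q = h qq"
  define k where "k = length V + 1"
  define Y where "Y = (\<lambda>j. if \<exists>i::nat. 1 \<le> i \<and> i \<le> w \<and> j = int k - int i then q * X j else X j)"
  interpret ev: comm_ring_map "msubst h X" by (rule comm_ring_map_msubst)
  have leg: "legal 2 (rev V)" and w: "w \<le> length V + 2"
    using legal_snoc[of 2 "rev V" w] Cons.prems by auto
  have IH: "(1 - q) ^ length V * msubst h Z (P_rev V) =
    (\<Sum>u\<in>words (length V + 2). word_weight q V u * word_monomial Z (int (length V)) u)" for Z
    using Cons.IH[OF leg] by (simp add: q_def)
  have rec: "msubst h X (P_rev (w # V)) = h (1 / (1 - qq)) *
      ((X (int k) - q ^ w) * msubst h X (P_rev V) + (1 - X (int k)) * msubst h Y (P_rev V))"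
    unfolding P_rev.simps Let_def k_def[symmetric] Y_def q_def
    by (simp add: ev.map_add ev.map_mult ev.map_diff ev.map_1 msubst_mconst msubst_mvar
        msubst_scale_last map_power algebra_simps)
  have "(1 - q) ^ length (w # V) * msubst h X (P_rev (w # V)) =
      ((1 - q) * h (1 / (1 - qq))) * ((X (int k) - q ^ w) * ((1 - q) ^ length V * msubst h X (P_rev V))
        + (1 - X (int k)) * ((1 - q) ^ length V * msubst h Y (P_rev V)))"
    unfolding rec by (simp add: algebra_simps)
  also have "\<dots> = (X (int k) - q ^ w) * ((1 - q) ^ length V * msubst h X (P_rev V))
        + (1 - X (int k)) * ((1 - q) ^ length V * msubst h Y (P_rev V))"
    using map_denominator by (simp add: q_def)
  also have "\<dots> = (\<Sum>u\<in>words (length V + 2). word_weight q V u * word_monomial X (int (length V)) u *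
      ((X (int k) - q ^ w) + (1 - X (int k)) * q ^ count_list (map colour (take w u)) True))"
  proof -
    have "word_monomial Y (int (length V)) u =
      q ^ count_list (map colour (take w u)) True * word_monomial X (int (length V)) u" for u
    proof (rule word_monomial_scaled)
      fix j assume "j \<le> int (length V)"
      then have "(\<exists>i::nat. 1 \<le> i \<and> i \<le> w \<and> j = int k - int i) \<longleftrightarrow> int (length V) - int w < j"
        by (auto simp: k_def intro!: exI[of _ "nat (int (length V) + 1 - j)"])
      then show "Y j = (if int (length V) - int w < j then q * X j else X j)"
        by (simp add: Y_def)
    qed
    then show ?thesis
      unfolding IH sum_distrib_left sum.distrib[symmetric]
      by (intro sum.cong refl) (simp add: algebra_simps)
  qed
  also have "\<dots> = (\<Sum>u\<in>words (length V + 2). \<Sum>c\<in>UNIV.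
      word_weight q (w # V) (c # u) * word_monomial X (int (length (w # V))) (c # u))"
  proof (intro sum.cong refl)
    fix u assume "u \<in> words (length V + 2)"
    then have "length (take w u) = w" using w by (simp add: words_def)
    then show "word_weight q V u * word_monomial X (int (length V)) u *
        ((X (int k) - q ^ w) + (1 - X (int k)) * q ^ count_list (map colour (take w u)) True)
      = (\<Sum>c\<in>UNIV. word_weight q (w # V) (c # u) * word_monomial X (int (length (w # V))) (c # u))"
      by (simp add: sum_letter weight_1100 colour_def k_def algebra_simps)
  qed
  also have "\<dots> = (\<Sum>u\<in>words (length (w # V) + 2).
      word_weight q (w # V) u * word_monomial X (int (length (w # V))) u)"
    using sum_words_Cons[of "\<lambda>u. word_weight q (w # V) u * word_monomial X (int (length (w # V))) u" "length V + 2"]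
    by (simp add: sum.swap[of _ UNIV] del: word_weight.simps word_monomial.simps)
  finally show ?case unfolding q_def .
qed

end

text \<open>
Setting all variables to \<open>x\<close>: the words built up to some step are summed against their
continuations, and the step is moved along the schedule until only the initial words are left. Both
initial words have one letter of colour \<open>1\<close>, whence the factor \<open>x\<close>.
\<close>

lemma sum_word_weight:
  fixes q x :: "'a::comm_ring_1"
  shows "(\<Sum>u\<in>words (length V + 2). word_weight q V u * x ^ count_list (map colour u) True *
      continuations (weight q x order_1100) f u)
    = x * (continuations (weight q x order_1100) (rev V @ f) [P1, N0]
      + q * continuations (weight q x order_1100) (rev V @ f) [N0, P1])"
proof (induction V arbitrary: f)
  case Nil
  show ?case
    by (simp add: numeral_2_eq_2 sum_words_2 sum_letter colour_def algebra_simps)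
next
  case (Cons w V)
  let ?C = "continuations (weight q x order_1100)"
  have wt: "weight q x order_1100 c u = (if colour c then x else 1) * weight q 1 order_1100 c u" for c u
    by (cases c) (simp_all add: weight_1100 colour_def)
  have "(\<Sum>u\<in>words (length (w # V) + 2). word_weight q (w # V) u * x ^ count_list (map colour u) True * ?C f u)
    = (\<Sum>u\<in>words (length V + 2). \<Sum>c\<in>UNIV.
        word_weight q (w # V) (c # u) * x ^ count_list (map colour (c # u)) True * ?C f (c # u))"
    using sum_words_Cons[of "\<lambda>u. word_weight q (w # V) u * x ^ count_list (map colour u) True * ?C f u" "length V + 2"]
    by (simp add: sum.swap[of _ UNIV] del: word_weight.simps list.map count_list.simps)
  also have "\<dots> = (\<Sum>u\<in>words (length V + 2). word_weight q V u * x ^ count_list (map colour u) True * ?C (w # f) u)"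
    by (intro sum.cong refl) (simp add: sum_letter wt[of _ "take w _"] colour_def algebra_simps)
  also have "\<dots> = x * (?C (rev (w # V) @ f) [P1, N0] + q * ?C (rev (w # V) @ f) [N0, P1])"
    using Cons.IH[of "w # f"] by (simp del: continuations.simps)
  finally show ?case .
qed

lemma (in schedule_evaluation) msubst_P_poly:
  assumes "legal 2 W"
  shows "(1 - h qq) ^ length W * msubst h (\<lambda>_. x) (P_poly W) =
    x * (continuations (weight (h qq) x order_1100) W [P1, N0]
      + h qq * continuations (weight (h qq) x order_1100) W [N0, P1])"
  using msubst_P_rev[of "rev W" "\<lambda>_. x"] sum_word_weight[where V = "rev W" and q = "h qq" and x = x and f = "[]"] assms
  by (simp add: P_poly_def word_monomial_const)

section \<open>The functional equation\<close>

lemma degree_continuations: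
  "degree (continuations (weight [:c:] [:0, 1:] L) f u :: 'a::comm_ring_1 poly) \<le> length f"
proof (induction f arbitrary: u)
  case (Cons w f)
  have deg: "degree (weight [:c:] [:0, 1:] L d v) \<le> 1" for d :: letter and v
  proof -
    have "degree (val [:0, 1 :: 'a:] d) \<le> 1"
      by (cases d) simp_all
    moreover have "degree ([:c:] ^ n) = 0" for n
      using degree_power_le[of "[:c:]" n] by simp
    ultimately show ?thesis
      unfolding weight_def by (intro order_trans[OF degree_mult_le]) simp
  qed
  show ?case
    unfolding continuations.simps
  proof (rule degree_sum_le)
    fix d :: letter
    show "degree (weight [:c:] [:0, 1:] L d (take w u) * continuations (weight [:c:] [:0, 1:] L) f (d # u))
        \<le> length (w # f)"
      using degree_mult_le[of "weight [:c:] [:0, 1:] L d (take w u)"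
          "continuations (weight [:c:] [:0, 1:] L) f (d # u)"] deg[of d "take w u"] Cons.IH[of "d # u"]
      by simp
  qed simp
qed simp

lemma legal_schedule_imp_legal:
  assumes "legal_schedule W"
  shows "legal 2 W"
proof -
  have "legal m W" if "W \<noteq> [] \<longrightarrow> W ! 0 \<le> m"
    "\<forall>j. Suc j < length W \<longrightarrow> W ! Suc j \<le> W ! j + 1" for m
    using that
  proof (induction W arbitrary: m)
    case (Cons w W)
    have "legal (Suc w) W"
    proof (rule Cons.IH)
      show "W \<noteq> [] \<longrightarrow> W ! 0 \<le> Suc w"
        using Cons.prems(2)[rule_format, of 0] by (cases W) auto
      show "\<forall>j. Suc j < length W \<longrightarrow> W ! Suc j \<le> W ! j + 1"
        using Cons.prems(2)[rule_format, of "Suc _"] by simp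
    qed
    then show ?case using Cons.prems(1) by simp
  qed simp
  then show ?thesis using assms by (simp add: legal_schedule_def)
qed

interpretation const: schedule_evaluation "\<lambda>c. [:c:]"
  by standard (simp_all flip: one_pCons)

interpretation emb: schedule_evaluation emb
  by standard (simp_all add: emb_def flip: one_pCons to_fract_add to_fract_mult)

lemma eval_at_pCons: "eval_at (pCons c p) y = emb c + y * eval_at p y"
  by (simp add: eval_at_def map_poly_pCons emb.map_0)

lemma eval_at_0: "eval_at 0 y = 0"
  by (simp add: eval_at_def)

lemma eval_at_add: "eval_at (p + r) y = eval_at p y + eval_at r y"
  by (induction p r rule: poly_induct2) (simp_all add: eval_at_pCons eval_at_0 emb.map_add algebra_simps)

lemma eval_at_smult: "eval_at (smult c p) y = emb c * eval_at p y"
  by (induction p) (simp_all add: eval_at_pCons eval_at_0 emb.map_mult algebra_simps)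

lemma eval_at_mult: "eval_at (p * r) y = eval_at p y * eval_at r y"
  by (induction p) (simp_all add: eval_at_pCons eval_at_0 eval_at_add eval_at_smult emb.map_0 algebra_simps)

lemma eval_at_const: "eval_at [:c:] y = emb c"
  by (simp add: eval_at_pCons eval_at_0)

interpretation eval: comm_ring_map "\<lambda>p. eval_at p y" for y
proof
  show "eval_at 1 y = 1"
    using eval_at_const[of 1 y] by (simp add: emb.map_1 flip: one_pCons)
qed (simp_all add: eval_at_add eval_at_mult eval_at_0)

lemma eval_at_monom: "eval_at (monom c n) y = emb c * y ^ n"
  by (induction n) (simp_all add: monom_0 monom_Suc eval_at_pCons eval_at_0 emb.map_0)

lemma eval_at_xx: "eval_at p xx = to_fract p"
proof (induction p)
  case (pCons c p)
  have "emb c + xx * to_fract p = to_fract ([:c:] + [:0, 1:] * p)"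
    by (simp only: emb_def xx_def to_fract_add to_fract_mult)
  then show ?case
    using pCons by (simp add: eval_at_pCons)
qed (simp add: eval_at_0)

lemma eval_at_Q_poly: "eval_at (Q_poly W) y = msubst emb (\<lambda>_. y) (P_poly W)"
  by (simp add: Q_poly_def msubst_def eval.map_sum eval.map_mult eval.map_prod eval.map_power
      eval_at_smult eval_at_pCons eval_at_0 emb.map_0 emb.map_1)

lemma Q_poly_eq:
  assumes "legal 2 W"
  shows "\<exists>G. degree G \<le> length W \<and> Q_poly W = pCons 0 G"
proof -
  let ?G = "continuations (weight [:qq:] [:0, 1:] order_1100) W [P1, N0]
      + [:qq:] * continuations (weight [:qq:] [:0, 1:] order_1100) W [N0, P1]"
  let ?c = "(1 - qq) ^ length W"
  have c: "?c \<noteq> 0" using const.qq_neq_1 by simp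
  have "[:?c:] = (1 - [:qq:]) ^ length W"
    by (simp add: const.map_power const.map_diff const.map_1)
  then have "[:?c:] * Q_poly W = [:0, 1:] * ?G"
    using const.msubst_P_poly[OF assms, of "[:0, 1:]"] by (simp only: Q_poly_def)
  then have "smult (1 / ?c) ([:?c:] * Q_poly W) = smult (1 / ?c) ([:0, 1:] * ?G)"
    by (simp only:)
  then have "Q_poly W = pCons 0 (smult (1 / ?c) ?G)"
    using const.qq_neq_1 by simp
  moreover have "degree ?G \<le> length W"
  proof (rule degree_add_le)
    show "degree ([:qq:] * continuations (weight [:qq:] [:0, 1:] order_1100) W [N0, P1]) \<le> length W"
      by (simp add: degree_continuations)
  qed (rule degree_continuations)
  then have "degree (smult (1 / ?c) ?G) \<le> length W"
    by (rule order_trans[OF degree_smult_le])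
  ultimately show ?thesis
    by blast
qed

lemma Q_poly_sum_monom:
  assumes "legal 2 W" "k = length W + 1"
  shows "Q_poly W = (\<Sum>r=1..k. monom (coeff (Q_poly W) r) r)"
proof (rule poly_eqI)
  fix n
  obtain G where G: "degree G \<le> length W" "Q_poly W = pCons 0 G"
    using Q_poly_eq[OF assms(1)] by blast
  have "coeff (Q_poly W) n = 0" if "n \<notin> {1..k}"
    using that G assms(2) by (cases n) (auto intro: coeff_eq_0)
  then show "coeff (Q_poly W) n = coeff (\<Sum>r=1..k. monom (coeff (Q_poly W) r) r) n"
    by (auto simp: coeff_sum)
qed

lemma emb_qq_power: "emb qq ^ j = to_fract [:qq ^ j:]"
  by (simp add: emb.map_power[symmetric]) (simp add: emb_def)

lemma Q_poly_functional_equation: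
  assumes leg: "legal 2 W" and k: "k = length W + 1"
  shows "(1 - emb qq / xx) * eval_at (Q_poly W) xx
      + xx ^ k * (1 - emb qq * xx) * eval_at (Q_poly W) (1 / xx)
    = (1 + xx ^ k) * emb ((1 - qq\<^sup>2) * (\<Prod>w\<leftarrow>W. qint w))"
proof -
  let ?q = "emb qq" and ?n = "length W"
  let ?F = "\<lambda>x. continuations (weight ?q x order_1100) W [P1, N0]
      + ?q * continuations (weight ?q x order_1100) W [N0, P1]"
  have qq0: "qq \<noteq> 0" by (simp add: qq_def)
  have q0: "?q \<noteq> 0" using qq0 by (simp add: emb_def)
  have x0: "xx \<noteq> 0" by (simp add: xx_def)
  have xq: "xx \<noteq> ?q ^ j" for j
    by (simp add: xx_def emb_qq_power)
  have qx: "?q ^ j * xx \<noteq> 1" for j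
  proof -
    have "?q ^ j * xx = to_fract ([:qq ^ j:] * [:0, 1:])"
      by (simp only: xx_def emb_qq_power to_fract_mult)
    also have "\<dots> \<noteq> to_fract 1"
      unfolding to_fract_eq_iff
    proof
      assume "[:qq ^ j:] * [:0, 1:] = 1"
      then have "degree ([:qq ^ j:] * [:0, 1:]) = degree (1 :: ratq poly)" by (simp only:)
      then show False using qq0 by simp
    qed
    finally show ?thesis by simp
  qed
  have q1: "1 - ?q \<noteq> 0"
    using emb.map_denominator by force
  have Q: "(1 - ?q) ^ ?n * eval_at (Q_poly W) y = y * ?F y" for y
    unfolding eval_at_Q_poly by (rule emb.msubst_P_poly[OF leg])
  have qint: "(1 - ?q) * emb (qint w) = 1 - ?q ^ w" for w
    using sum_gp_basic[of ?q "w - 1"] 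
    by (cases w) (simp_all add: qint_def emb.map_sum emb.map_power emb.map_0 lessThan_Suc_atMost)
  have prod: "(1 - ?q) ^ length V * emb (\<Prod>w\<leftarrow>V. qint w) = (\<Prod>w\<leftarrow>V. 1 - ?q ^ w)" for V
    by (induction V) (simp_all add: emb.map_1 emb.map_mult mult_ac flip: qint)
  have "(1 - ?q) ^ ?n * ((1 - ?q / xx) * eval_at (Q_poly W) xx
      + xx ^ k * (1 - ?q * xx) * eval_at (Q_poly W) (1 / xx))
    = (1 - ?q / xx) * ((1 - ?q) ^ ?n * eval_at (Q_poly W) xx)
      + xx ^ k * (1 - ?q * xx) * ((1 - ?q) ^ ?n * eval_at (Q_poly W) (1 / xx))"
    by (simp add: algebra_simps)
  also have "\<dots> = (xx - ?q) * ?F xx + (1 - ?q * xx) * xx ^ ?n * ?F (1 / xx)"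
    unfolding Q using x0 k by (simp add: field_simps)
  also have "\<dots> = (1 - ?q\<^sup>2) * (1 + xx ^ (?n + 1)) * (\<Prod>w\<leftarrow>W. 1 - ?q ^ w)"
    by (rule functional_equation[OF q0 x0 xq qx leg])
  also have "\<dots> = (1 - ?q) ^ ?n * ((1 + xx ^ k) * emb ((1 - qq\<^sup>2) * (\<Prod>w\<leftarrow>W. qint w)))"
    by (simp add: k emb.map_mult emb.map_diff emb.map_1 emb.map_power flip: prod)
  finally show ?thesis using q1 by simp
qed

text \<open>
After multiplication by \<open>x\<close> the equation holds between polynomials, and the coefficients of
\<open>x\<^bsup>k+1\<^esup>\<close> are compared.
\<close>

lemma extreme_coefficients:
  assumes "k \<ge> 1" and p: "p = (\<Sum>r=1..k. monom (coeff p r) r)"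
    and eq: "(1 - emb qq / xx) * eval_at p xx + xx ^ k * (1 - emb qq * xx) * eval_at p (1 / xx)
      = (1 + xx ^ k) * emb c"
  shows "coeff p k - qq * coeff p 1 = c"
proof -
  have x0: "xx \<noteq> 0" by (simp add: xx_def)
  define r where "r = (\<Sum>j=1..k. monom (coeff p j) (k + 1 - j))"
  have rev: "xx ^ (k + 1) * eval_at p (1 / xx) = to_fract r"
  proof -
    have "xx ^ (k + 1) * eval_at p (1 / xx) = (\<Sum>j=1..k. xx ^ (k + 1) * (emb (coeff p j) * (1 / xx) ^ j))"
      by (subst p) (simp only: eval.map_sum eval_at_monom sum_distrib_left)
    also have "\<dots> = (\<Sum>j=1..k. emb (coeff p j) * xx ^ (k + 1 - j))"
      using x0 by (intro sum.cong refl) (auto simp: power_diff field_simps)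
    also have "\<dots> = to_fract r"
      unfolding r_def by (simp only: eval_at_xx[symmetric] eval.map_sum eval_at_monom)
    finally show ?thesis .
  qed
  have "to_fract ([:- qq, 1:] * p + [:1, - qq:] * r) = (xx - emb qq) * eval_at p xx
      + (1 - emb qq * xx) * (xx ^ (k + 1) * eval_at p (1 / xx))"
    unfolding rev
    by (simp only: eval_at_xx[symmetric] eval_at_add eval_at_mult eval_at_pCons eval_at_0)
      (simp add: emb.map_uminus emb.map_1 algebra_simps)
  also have "\<dots> = xx * ((1 - emb qq / xx) * eval_at p xx
      + xx ^ k * (1 - emb qq * xx) * eval_at p (1 / xx))"
    using x0 by (simp add: field_simps)
  also have "\<dots> = to_fract (monom c 1 + monom c (k + 1))"
    unfolding eq by (simp add: eval_at_monom algebra_simps flip: eval_at_xx eval_at_add)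
      (simp add: eval_at_add eval_at_monom)
  finally have "[:- qq, 1:] * p + [:1, - qq:] * r = monom c 1 + monom c (k + 1)"
    by (simp only: to_fract_eq_iff)
  then have "coeff ([:- qq, 1:] * p + [:1, - qq:] * r) (k + 1) = c"
    using assms(1) by simp
  moreover have "coeff p (k + 1) = 0"
    by (subst p) (simp add: coeff_sum)
  moreover have "coeff r (k + 1) = 0" "coeff r k = coeff p 1"
  proof -
    have "coeff r (k + 1) = (\<Sum>j=1..k. if j = 0 then coeff p j else 0)"
      unfolding r_def coeff_sum by (intro sum.cong) auto
    then show "coeff r (k + 1) = 0" by simp
    have "coeff r k = (\<Sum>j=1..k. if j = 1 then coeff p j else 0)"
      unfolding r_def coeff_sum by (intro sum.cong) auto
    then show "coeff r k = coeff p 1" using assms(1) by simp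
  qed
  ultimately show ?thesis by simp
qed

theorem mainTheorem1:
  fixes k :: nat and W :: "nat list" and A :: "nat \<Rightarrow> ratq"
  assumes "k \<ge> 1"
    and "length W = k - 1"
    and "legal_schedule W"
    and "\<And>r. A r = coeff (Q_poly W) r"
  shows "Q_poly W = (\<Sum>r=1..k. monom (A r) r) \<and>
    (1 - emb qq / xx) * eval_at (Q_poly W) xx
        + xx ^ k * (1 - emb qq * xx) * eval_at (Q_poly W) (1 / xx)
      = (1 + xx ^ k) * emb (A k - qq * A 1) \<and>
    (1 + xx ^ k) * emb (A k - qq * A 1)
      = (1 + xx ^ k) * emb ((1 - qq\<^sup>2) * (\<Prod>i=1..k-1. qint (W ! (i - 1))))"
proof -
  have k: "k = length W + 1" using assms(1,2) by simp
  have leg: "legal 2 W" by (rule legal_schedule_imp_legal[OF assms(3)])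
  have "(\<Prod>i=1..k-1. qint (W ! (i - 1))) = (\<Prod>i<length W. qint (W ! i))"
    by (rule prod.reindex_bij_witness[of _ Suc "\<lambda>i. i - 1"]) (use k in auto)
  then have prod: "(\<Prod>i=1..k-1. qint (W ! (i - 1))) = (\<Prod>w\<leftarrow>W. qint w)"
    by (simp add: prod.list_conv_set_nth atLeast0LessThan)
  have Q: "Q_poly W = (\<Sum>r=1..k. monom (A r) r)"
    unfolding assms(4) by (rule Q_poly_sum_monom[OF leg k])
  note FE = Q_poly_functional_equation[OF leg k]
  have A: "A k - qq * A 1 = (1 - qq\<^sup>2) * (\<Prod>w\<leftarrow>W. qint w)"
    unfolding assms(4) by (rule extreme_coefficients[OF assms(1) Q_poly_sum_monom[OF leg k] FE])
  show ?thesis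
    using Q FE unfolding prod A by blast
qed

end
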